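(* Let $\mathcal{D}$ be an exact category. If $V\in\mathcal{D}$ is an extended tilting object, then $\mathrm{Gen}(V)=V^{\perp_1}$.
   Context: An exact category $\mathcal{D}$ (in the sense of Quillen) is regarded as an extriangulated category with $\mathbb{E}=\mathrm{Ext}^1_{\mathcal{D}}$ (Yoneda $\mathrm{Ext}$ of the exact structure) and with negative first extension $\mathbb{E}^{-1}=0$; its $\mathfrak{s}$-conflations are the conflations (admissible short exact sequences) of $\mathcal{D}$. An $s$-torsion pair in $\mathcal{D}$ is then a torsion pair: a pair $(\mathcal{T},\mathcal{F})$ of full isomorphism-closed subcategories with $\mathrm{Hom}_{\mathcal{D}}(\mathcal{T},\mathcal{F})=0$ such that every $D\in\mathcal{D}$ admits a conflation $T\to D\to F$ with $T\in\mathcal{T}$, $F\in\mathcal{F}$. For $V\in\mathcal{D}$: $V^{\perp_0}=\{X:\mathrm{Hom}_{\mathcal{D}}(V,X)=0\}$ and $V^{\perp_1}=\{X:\mathbb{E}(V,X)=0\}$. $\mathrm{Gen}(V)$ is the class of $X$ such that $X=0$ or there is a conflation $A\to\coprod_\alpha V\xrightarrow{f}X$ for some set $\alpha$ (for which the coproduct exists in $\mathcal{D}$) with $f\ne0$; $\mathrm{Pres}(V)$ is the class of $X$ such that $X=0$ or there is such a conflation with moreover $A\in\mathrm{Gen}(V)$. A class $\mathcal{S}$ is cogenerating in $\mathcal{D}$ if every $X\in\mathcal{D}$ admits a conflation $X\to S\to X'$ with $S\in\mathcal{S}$. $V$ is extended tilting if (T1) $(\mathrm{Gen}(V),V^{\perp_0})$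 is an $s$-torsion pair in $\mathcal{D}$; (T2) $\mathrm{Gen}(V)=\mathrm{Pres}(V)$ and $\mathrm{Gen}(V)\subseteq V^{\perp_1}$; (T3) $\mathrm{Gen}(V)$ is cogenerating in $\mathcal{D}$. *)

theory Defs
  imports "HOL-Algebra.Group"
begin

section \<open>Categories\<close>

record ('o, 'm) category =
  Obj :: "'o set"
  Arr :: "'m set"
  Dom :: "'m \<Rightarrow> 'o"
  Cod :: "'m \<Rightarrow> 'o"
  Ident :: "'o \<Rightarrow> 'm"
  Comp :: "'m \<Rightarrow> 'm \<Rightarrow> 'm"  (infixl \<open>\<cdot>\<index>\<close> 70)

definition Hom :: "('o, 'm, 'z) category_scheme \<Rightarrow> 'o \<Rightarrow> 'o \<Rightarrow> 'm set" where
  "Hom C X Y = {f \<in> Arr C. Dom C f = X \<and> Cod C f = Y}"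

locale category =
  fixes C :: "('o, 'm, 'z) category_scheme" (structure)
  assumes Dom_Obj: "f \<in> Arr C \<Longrightarrow> Dom C f \<in> Obj C"
    and Cod_Obj: "f \<in> Arr C \<Longrightarrow> Cod C f \<in> Obj C"
    and Ident_Hom: "X \<in> Obj C \<Longrightarrow> Ident C X \<in> Hom C X X"
    and Comp_Hom: "f \<in> Hom C X Y \<Longrightarrow> g \<in> Hom C Y Z \<Longrightarrow> g \<cdot> f \<in> Hom C X Z"
    and Comp_Ident_left: "f \<in> Hom C X Y \<Longrightarrow> Ident C Y \<cdot> f = f"
    and Comp_Ident_right: "f \<in> Hom C X Y \<Longrightarrow> f \<cdot> Ident C X = f"
    and Comp_assoc: "f \<in> Hom C W X \<Longrightarrow> g \<in> Hom C X Y \<Longrightarrow> h \<in> Hom C Y Z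
          \<Longrightarrow> (h \<cdot> g) \<cdot> f = h \<cdot> (g \<cdot> f)"

definition is_iso :: "('o, 'm, 'z) category_scheme \<Rightarrow> 'm \<Rightarrow> bool" where
  "is_iso C f \<longleftrightarrow> f \<in> Arr C \<and>
     (\<exists>g \<in> Hom C (Cod C f) (Dom C f).
        g \<cdot>\<^bsub>C\<^esub> f = Ident C (Dom C f) \<and> f \<cdot>\<^bsub>C\<^esub> g = Ident C (Cod C f))"

definition isomorphic :: "('o, 'm, 'z) category_scheme \<Rightarrow> 'o \<Rightarrow> 'o \<Rightarrow> bool" where
  "isomorphic C X Y \<longleftrightarrow> (\<exists>f \<in> Hom C X Y. is_iso C f)"

definition iso_closed :: "('o, 'm, 'z) category_scheme \<Rightarrow> 'o set \<Rightarrow> bool" where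
  "iso_closed C S \<longleftrightarrow> (\<forall>X \<in> S. \<forall>Y \<in> Obj C. isomorphic C X Y \<longrightarrow> Y \<in> S)"

definition is_zero_object :: "('o, 'm, 'z) category_scheme \<Rightarrow> 'o \<Rightarrow> bool" where
  "is_zero_object C Z \<longleftrightarrow> Z \<in> Obj C \<and>
     (\<forall>X \<in> Obj C. (\<exists>!f. f \<in> Hom C X Z) \<and> (\<exists>!f. f \<in> Hom C Z X))"

definition is_coproduct ::
    "('o, 'm, 'z) category_scheme \<Rightarrow> 'i set \<Rightarrow> ('i \<Rightarrow> 'o) \<Rightarrow> 'o \<Rightarrow> ('i \<Rightarrow> 'm) \<Rightarrow> bool" where
  "is_coproduct C I D P \<iota> \<longleftrightarrow> P \<in> Obj C \<and> (\<forall>a \<in> I. \<iota> a \<in> Hom C (D a) P) \<and>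
     (\<forall>Y \<in> Obj C. \<forall>g. (\<forall>a \<in> I. g a \<in> Hom C (D a) Y) \<longrightarrow>
        (\<exists>!h. h \<in> Hom C P Y \<and> (\<forall>a \<in> I. h \<cdot>\<^bsub>C\<^esub> \<iota> a = g a)))"

text \<open>A coproduct of copies of a single object can always be indexed by a set of morphisms.\<close>

lemma is_coproduct_copies_reindex:
  fixes I :: "'i set" and C :: "('o, 'm, 'z) category_scheme"
  assumes "is_coproduct C I (\<lambda>_. V) P \<iota>"
  shows "is_coproduct C (\<iota> ` I) (\<lambda>_. V) P (\<lambda>j. j)"
  unfolding is_coproduct_def
proof (intro conjI ballI allI impI)
  show "P \<in> Obj C"
    using assms by (simp add: is_coproduct_def)
  show "j \<in> Hom C V P" if "j \<in> \<iota> ` I" for j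
    using assms that by (auto simp: is_coproduct_def)
  fix Y g
  assume Y: "Y \<in> Obj C" and g: "\<forall>j \<in> \<iota> ` I. g j \<in> Hom C V Y"
  have univ: "\<And>g. \<forall>a \<in> I. g a \<in> Hom C V Y \<Longrightarrow>
      \<exists>!h. h \<in> Hom C P Y \<and> (\<forall>a \<in> I. h \<cdot>\<^bsub>C\<^esub> \<iota> a = g a)"
    using assms Y by (simp add: is_coproduct_def)
  show "\<exists>!h. h \<in> Hom C P Y \<and> (\<forall>j \<in> \<iota> ` I. h \<cdot>\<^bsub>C\<^esub> j = g j)"
    using univ[of "\<lambda>a. g (\<iota> a)"] g by simp
qed

text \<open>\<open>f : A \<rightarrow> B\<close>, \<open>g : A \<rightarrow> B'\<close>, with pushout maps \<open>f' : B' \<rightarrow> P\<close> (opposite \<open>f\<close>)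
  and \<open>g' : B \<rightarrow> P\<close> (opposite \<open>g\<close>); dually for pullbacks.\<close>

definition is_pushout ::
    "('o, 'm, 'z) category_scheme \<Rightarrow> 'm \<Rightarrow> 'm \<Rightarrow> 'm \<Rightarrow> 'm \<Rightarrow> bool" where
  "is_pushout C f g f' g' \<longleftrightarrow>
     {f, g, f', g'} \<subseteq> Arr C \<and> Dom C f = Dom C g \<and> Dom C g' = Cod C f \<and> Dom C f' = Cod C g \<and>
     Cod C f' = Cod C g' \<and> g' \<cdot>\<^bsub>C\<^esub> f = f' \<cdot>\<^bsub>C\<^esub> g \<and>
     (\<forall>Y \<in> Obj C. \<forall>u \<in> Hom C (Cod C f) Y. \<forall>v \<in> Hom C (Cod C g) Y.
        u \<cdot>\<^bsub>C\<^esub> f = v \<cdot>\<^bsub>C\<^esub> g \<longrightarrow>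
        (\<exists>!h. h \<in> Hom C (Cod C f') Y \<and> h \<cdot>\<^bsub>C\<^esub> g' = u \<and> h \<cdot>\<^bsub>C\<^esub> f' = v))"

definition is_pullback ::
    "('o, 'm, 'z) category_scheme \<Rightarrow> 'm \<Rightarrow> 'm \<Rightarrow> 'm \<Rightarrow> 'm \<Rightarrow> bool" where
  "is_pullback C f g f' g' \<longleftrightarrow>
     {f, g, f', g'} \<subseteq> Arr C \<and> Cod C f = Cod C g \<and> Cod C g' = Dom C f \<and> Cod C f' = Dom C g \<and>
     Dom C f' = Dom C g' \<and> f \<cdot>\<^bsub>C\<^esub> g' = g \<cdot>\<^bsub>C\<^esub> f' \<and>
     (\<forall>Y \<in> Obj C. \<forall>u \<in> Hom C Y (Dom C f). \<forall>v \<in> Hom C Y (Dom C g).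
        f \<cdot>\<^bsub>C\<^esub> u = g \<cdot>\<^bsub>C\<^esub> v \<longrightarrow>
        (\<exists>!h. h \<in> Hom C Y (Dom C f') \<and> g' \<cdot>\<^bsub>C\<^esub> h = u \<and> f' \<cdot>\<^bsub>C\<^esub> h = v))"


section \<open>Additive categories\<close>

record ('o, 'm) preadditive = "('o, 'm) category" +
  Add :: "'m \<Rightarrow> 'm \<Rightarrow> 'm"  (infixl \<open>\<boxplus>\<index>\<close> 65)
  Zero :: "'o \<Rightarrow> 'o \<Rightarrow> 'm"

definition Hom_group :: "('o, 'm, 'z) preadditive_scheme \<Rightarrow> 'o \<Rightarrow> 'o \<Rightarrow> 'm monoid" where
  "Hom_group C X Y = \<lparr>carrier = Hom C X Y, monoid.mult = Add C, one = Zero C X Y\<rparr>"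

locale preadditive_category = category C
  for C :: "('o, 'm, 'z) preadditive_scheme" (structure) +
  assumes Hom_comm_group: "X \<in> Obj C \<Longrightarrow> Y \<in> Obj C \<Longrightarrow> comm_group (Hom_group C X Y)"
    and Comp_Add_left: "f \<in> Hom C X Y \<Longrightarrow> g \<in> Hom C Y Z \<Longrightarrow> h \<in> Hom C Y Z
          \<Longrightarrow> (g \<boxplus> h) \<cdot> f = (g \<cdot> f) \<boxplus> (h \<cdot> f)"
    and Comp_Add_right: "f \<in> Hom C X Y \<Longrightarrow> g \<in> Hom C X Y \<Longrightarrow> h \<in> Hom C Y Z
          \<Longrightarrow> h \<cdot> (f \<boxplus> g) = (h \<cdot> f) \<boxplus> (h \<cdot> g)"

definition is_biproduct ::
    "('o, 'm, 'z) preadditive_scheme \<Rightarrow> 'o \<Rightarrow> 'o \<Rightarrow> 'o \<Rightarrow> 'm \<Rightarrow> 'm \<Rightarrow> 'm \<Rightarrow> 'm \<Rightarrow> bool" where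
  "is_biproduct C X Y B i j p q \<longleftrightarrow> B \<in> Obj C \<and>
     i \<in> Hom C X B \<and> j \<in> Hom C Y B \<and> p \<in> Hom C B X \<and> q \<in> Hom C B Y \<and>
     p \<cdot>\<^bsub>C\<^esub> i = Ident C X \<and> q \<cdot>\<^bsub>C\<^esub> j = Ident C Y \<and>
     p \<cdot>\<^bsub>C\<^esub> j = Zero C Y X \<and> q \<cdot>\<^bsub>C\<^esub> i = Zero C X Y \<and>
     (i \<cdot>\<^bsub>C\<^esub> p) \<boxplus>\<^bsub>C\<^esub> (j \<cdot>\<^bsub>C\<^esub> q) = Ident C B"

locale additive_category = preadditive_category C
  for C :: "('o, 'm, 'z) preadditive_scheme" (structure) +
  assumes zero_object: "\<exists>Z. is_zero_object C Z"
    and biproducts: "X \<in> Obj C \<Longrightarrow> Y \<in> Obj C \<Longrightarrow> \<exists>B i j p q. is_biproduct C X Y B i j p q"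

definition is_kernel :: "('o, 'm, 'z) preadditive_scheme \<Rightarrow> 'm \<Rightarrow> 'm \<Rightarrow> bool" where
  "is_kernel C k p \<longleftrightarrow> k \<in> Arr C \<and> p \<in> Arr C \<and> Cod C k = Dom C p \<and>
     p \<cdot>\<^bsub>C\<^esub> k = Zero C (Dom C k) (Cod C p) \<and>
     (\<forall>Y \<in> Obj C. \<forall>g \<in> Hom C Y (Dom C p). p \<cdot>\<^bsub>C\<^esub> g = Zero C Y (Cod C p) \<longrightarrow>
        (\<exists>!h. h \<in> Hom C Y (Dom C k) \<and> k \<cdot>\<^bsub>C\<^esub> h = g))"

definition is_cokernel :: "('o, 'm, 'z) preadditive_scheme \<Rightarrow> 'm \<Rightarrow> 'm \<Rightarrow> bool" where
  "is_cokernel C p i \<longleftrightarrow> p \<in> Arr C \<and> i \<in> Arr C \<and> Dom C p = Cod C i \<and>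
     p \<cdot>\<^bsub>C\<^esub> i = Zero C (Dom C i) (Cod C p) \<and>
     (\<forall>Y \<in> Obj C. \<forall>g \<in> Hom C (Cod C i) Y. g \<cdot>\<^bsub>C\<^esub> i = Zero C (Dom C i) Y \<longrightarrow>
        (\<exists>!h. h \<in> Hom C (Cod C p) Y \<and> h \<cdot>\<^bsub>C\<^esub> p = g))"

definition kernel_cokernel_pair :: "('o, 'm, 'z) preadditive_scheme \<Rightarrow> 'm \<times> 'm \<Rightarrow> bool" where
  "kernel_cokernel_pair C e \<longleftrightarrow> is_kernel C (fst e) (snd e) \<and> is_cokernel C (snd e) (fst e)"

definition iso_pairs :: "('o, 'm, 'z) preadditive_scheme \<Rightarrow> 'm \<times> 'm \<Rightarrow> 'm \<times> 'm \<Rightarrow> bool" where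
  "iso_pairs C e e' \<longleftrightarrow> (\<exists>a b c. is_iso C a \<and> is_iso C b \<and> is_iso C c \<and>
     a \<in> Hom C (Dom C (fst e)) (Dom C (fst e')) \<and>
     b \<in> Hom C (Cod C (fst e)) (Cod C (fst e')) \<and>
     c \<in> Hom C (Cod C (snd e)) (Cod C (snd e')) \<and>
     b \<cdot>\<^bsub>C\<^esub> fst e = fst e' \<cdot>\<^bsub>C\<^esub> a \<and> c \<cdot>\<^bsub>C\<^esub> snd e = snd e' \<cdot>\<^bsub>C\<^esub> b)"


section \<open>Exact categories\<close>

text \<open>\<open>Confl\<close> is the chosen class of conflations, a pair \<open>(i, p)\<close> standing for
  \<open>Dom i \<rightarrow> Cod i = Dom p \<rightarrow> Cod p\<close>.\<close>

record ('o, 'm) exact = "('o, 'm) preadditive" +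
  Confl :: "('m \<times> 'm) set"

definition adm_mono :: "('o, 'm, 'z) exact_scheme \<Rightarrow> 'm \<Rightarrow> bool" where
  "adm_mono C i \<longleftrightarrow> (\<exists>p. (i, p) \<in> Confl C)"

definition adm_epi :: "('o, 'm, 'z) exact_scheme \<Rightarrow> 'm \<Rightarrow> bool" where
  "adm_epi C p \<longleftrightarrow> (\<exists>i. (i, p) \<in> Confl C)"

text \<open>Quillen's axioms, in the form given by Buehler.\<close>

locale exact_category = additive_category C
  for C :: "('o, 'm, 'z) exact_scheme" (structure) +
  assumes Confl_kernel_cokernel: "e \<in> Confl C \<Longrightarrow> kernel_cokernel_pair C e"
    and Confl_iso_closed: "e \<in> Confl C \<Longrightarrow> kernel_cokernel_pair C e' \<Longrightarrow> iso_pairs C e e'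
          \<Longrightarrow> e' \<in> Confl C"
    and adm_mono_Ident: "X \<in> Obj C \<Longrightarrow> adm_mono C (Ident C X)"
    and adm_epi_Ident: "X \<in> Obj C \<Longrightarrow> adm_epi C (Ident C X)"
    and adm_mono_Comp: "adm_mono C i \<Longrightarrow> adm_mono C j \<Longrightarrow> Cod C i = Dom C j
          \<Longrightarrow> adm_mono C (j \<cdot> i)"
    and adm_epi_Comp: "adm_epi C p \<Longrightarrow> adm_epi C q \<Longrightarrow> Cod C p = Dom C q
          \<Longrightarrow> adm_epi C (q \<cdot> p)"
    and adm_mono_pushout: "adm_mono C i \<Longrightarrow> f \<in> Arr C \<Longrightarrow> Dom C f = Dom C i
          \<Longrightarrow> \<exists>i' f'. is_pushout C i f i' f' \<and> adm_mono C i'"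
    and adm_epi_pullback: "adm_epi C p \<Longrightarrow> f \<in> Arr C \<Longrightarrow> Cod C f = Cod C p
          \<Longrightarrow> \<exists>p' f'. is_pullback C p f p' f' \<and> adm_epi C p'"


section \<open>Yoneda extensions\<close>

text \<open>\<open>Extensions C V X\<close> consists of the conflations \<open>X \<rightarrow> E \<rightarrow> V\<close>.\<close>

definition Extensions :: "('o, 'm, 'z) exact_scheme \<Rightarrow> 'o \<Rightarrow> 'o \<Rightarrow> ('m \<times> 'm) set" where
  "Extensions C V X = {(i, p) \<in> Confl C. Dom C i = X \<and> Cod C p = V}"

definition Ext_rel ::
    "('o, 'm, 'z) exact_scheme \<Rightarrow> 'o \<Rightarrow> 'o \<Rightarrow> (('m \<times> 'm) \<times> ('m \<times> 'm)) set" where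
  "Ext_rel C V X = {((i, p), (i', p')). (i, p) \<in> Extensions C V X \<and> (i', p') \<in> Extensions C V X \<and>
     (\<exists>h \<in> Hom C (Cod C i) (Cod C i'). is_iso C h \<and> h \<cdot>\<^bsub>C\<^esub> i = i' \<and> p' \<cdot>\<^bsub>C\<^esub> h = p)}"

definition Ext1 :: "('o, 'm, 'z) exact_scheme \<Rightarrow> 'o \<Rightarrow> 'o \<Rightarrow> ('m \<times> 'm) set set" where
  "Ext1 C V X = Extensions C V X // Ext_rel C V X"

text \<open>The neutral element of \<open>Ext1 C V X\<close> under the Baer sum: the class of the split extensions
  \<open>X \<rightarrow> X \<oplus> V \<rightarrow> V\<close>.\<close>

definition Ext1_zero :: "('o, 'm, 'z) exact_scheme \<Rightarrow> 'o \<Rightarrow> 'o \<Rightarrow> ('m \<times> 'm) set" where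
  "Ext1_zero C V X =
     {(i, p) \<in> Extensions C V X. \<exists>j q. is_biproduct C X V (Cod C i) i j q p}"


section \<open>Torsion pairs and extended tilting objects\<close>

definition perp0 :: "('o, 'm, 'z) exact_scheme \<Rightarrow> 'o \<Rightarrow> 'o set" where
  "perp0 C V = {X \<in> Obj C. Hom C V X = {Zero C V X}}"

definition perp1 :: "('o, 'm, 'z) exact_scheme \<Rightarrow> 'o \<Rightarrow> 'o set" where
  "perp1 C V = {X \<in> Obj C. Ext1 C V X = {Ext1_zero C V X}}"

text \<open>The condition on the negative first extension in the definition of an s-torsion pair is
  void, since that bifunctor is zero on an exact category.\<close>

definition s_torsion_pair :: "('o, 'm, 'z) exact_scheme \<Rightarrow> 'o set \<Rightarrow> 'o set \<Rightarrow> bool" where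
  "s_torsion_pair C T F \<longleftrightarrow>
     T \<subseteq> Obj C \<and> F \<subseteq> Obj C \<and> iso_closed C T \<and> iso_closed C F \<and>
     (\<forall>X \<in> T. \<forall>Y \<in> F. Hom C X Y = {Zero C X Y}) \<and>
     (\<forall>D \<in> Obj C. \<exists>(i, p) \<in> Confl C. Dom C i \<in> T \<and> Cod C i = D \<and> Cod C p \<in> F)"

text \<open>Restricting the index set \<open>I\<close> to sets of morphisms loses nothing, by
  \<open>is_coproduct_copies_reindex\<close>.\<close>

definition Gen :: "('o, 'm, 'z) exact_scheme \<Rightarrow> 'o \<Rightarrow> 'o set" where
  "Gen C V = {X \<in> Obj C. is_zero_object C X \<or>
     (\<exists>(k, f) \<in> Confl C. \<exists>(I :: 'm set) \<iota>.
        is_coproduct C I (\<lambda>_. V) (Dom C f) \<iota> \<and> Cod C f = X \<and> f \<noteq> Zero C (Dom C f) X)}"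

definition Pres :: "('o, 'm, 'z) exact_scheme \<Rightarrow> 'o \<Rightarrow> 'o set" where
  "Pres C V = {X \<in> Obj C. is_zero_object C X \<or>
     (\<exists>(k, f) \<in> Confl C. \<exists>(I :: 'm set) \<iota>.
        is_coproduct C I (\<lambda>_. V) (Dom C f) \<iota> \<and> Cod C f = X \<and> f \<noteq> Zero C (Dom C f) X \<and>
        Dom C k \<in> Gen C V)}"

definition cogenerating :: "('o, 'm, 'z) exact_scheme \<Rightarrow> 'o set \<Rightarrow> bool" where
  "cogenerating C S \<longleftrightarrow>
     (\<forall>X \<in> Obj C. \<exists>(i, p) \<in> Confl C. Dom C i = X \<and> Cod C i \<in> S)"

definition extended_tilting :: "('o, 'm, 'z) exact_scheme \<Rightarrow> 'o \<Rightarrow> bool" where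
  "extended_tilting C V \<longleftrightarrow> V \<in> Obj C \<and>
     s_torsion_pair C (Gen C V) (perp0 C V) \<and>
     Gen C V = Pres C V \<and> Gen C V \<subseteq> perp1 C V \<and>
     cogenerating C (Gen C V)"

end

theory Submission
  imports Defs
begin

text \<open>Let \<open>X \<in> V\<^sup>\<bottom>\<^sup>1\<close>. Embed \<open>X\<close> by a conflation \<open>X \<rightarrow> S \<rightarrow> X'\<close> with \<open>S \<in> Gen V\<close>; then also
  \<open>X' \<in> Gen V = Pres V\<close>, so there is a conflation \<open>A \<rightarrow> P \<rightarrow> X'\<close> with \<open>P\<close> a coproduct of copies of
  \<open>V\<close> and \<open>A \<in> Gen V\<close>. In the pullback \<open>E\<close> of \<open>S \<rightarrow> X' \<leftarrow> P\<close>, the extension \<open>X \<rightarrow> E \<rightarrow> P\<close> splits,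
  because every \<open>V \<rightarrow> X'\<close> lifts to \<open>S\<close>, while \<open>A \<rightarrow> E \<rightarrow> S\<close> exhibits \<open>E\<close> as an extension of torsion
  objects. So \<open>X\<close>, a quotient of \<open>E\<close>, has no nonzero map to a torsion-free object.\<close>

lemma Hom_iff: "f \<in> Hom C X Y \<longleftrightarrow> f \<in> Arr C \<and> Dom C f = X \<and> Cod C f = Y"
  by (simp add: Hom_def)

section \<open>Universal property of pullbacks\<close>

context category
begin

lemma Hom_Obj: "f \<in> Hom C X Y \<Longrightarrow> X \<in> Obj C" "f \<in> Hom C X Y \<Longrightarrow> Y \<in> Obj C"
  using Dom_Obj Cod_Obj by (auto simp: Hom_iff)

text \<open>The universal property is split into existence of a factorization and joint left
  cancellation. For the latter, \<open>g' \<cdot> h\<close> and \<open>f' \<cdot> h\<close> form a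
  compatible pair because the square commutes, and both \<open>h\<close> and \<open>h'\<close>
  factor it.\<close>

lemma is_pullbackE:
  assumes "is_pullback C f g f' g'" "f \<in> Hom C X Z" "g \<in> Hom C Y Z"
  obtains Q where "f' \<in> Hom C Q Y" "g' \<in> Hom C Q X" "f \<cdot> g' = g \<cdot> f'"
    "\<And>W u v. u \<in> Hom C W X \<Longrightarrow> v \<in> Hom C W Y \<Longrightarrow> f \<cdot> u = g \<cdot> v
       \<Longrightarrow> \<exists>h \<in> Hom C W Q. g' \<cdot> h = u \<and> f' \<cdot> h = v"
    "\<And>W h h'. h \<in> Hom C W Q \<Longrightarrow> h' \<in> Hom C W Q \<Longrightarrow> g' \<cdot> h = g' \<cdot> h' \<Longrightarrow> f' \<cdot> h = f' \<cdot> h'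
       \<Longrightarrow> h = h'"
proof (rule that[of "Dom C f'"])
  show f': "f' \<in> Hom C (Dom C f') Y" and g': "g' \<in> Hom C (Dom C f') X"
    and comm: "f \<cdot> g' = g \<cdot> f'"
    using assms by (auto simp: is_pullback_def Hom_iff)
  have univ: "\<exists>!h. h \<in> Hom C W (Dom C f') \<and> g' \<cdot> h = u \<and> f' \<cdot> h = v"
    if "u \<in> Hom C W X" "v \<in> Hom C W Y" "f \<cdot> u = g \<cdot> v" for W u v
  proof -
    have "Dom C f = X" "Dom C g = Y" using assms by (auto simp: Hom_iff)
    then show ?thesis
      using assms(1) that Hom_Obj(1)[OF that(1)] unfolding is_pullback_def by blast
  qed
  show "\<exists>h \<in> Hom C W (Dom C f'). g' \<cdot> h = u \<and> f' \<cdot> h = v"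
    if "u \<in> Hom C W X" "v \<in> Hom C W Y" "f \<cdot> u = g \<cdot> v" for W u v
    using univ[OF that] by blast
  show "h = h'"
    if h: "h \<in> Hom C W (Dom C f')" "h' \<in> Hom C W (Dom C f')"
      and eq: "g' \<cdot> h = g' \<cdot> h'" "f' \<cdot> h = f' \<cdot> h'" for W h h'
  proof -
    have "f \<cdot> (g' \<cdot> h) = g \<cdot> (f' \<cdot> h)"
      using Comp_assoc[OF h(1) g' assms(2)] Comp_assoc[OF h(1) f' assms(3)] comm by simp
    from univ[OF Comp_Hom[OF h(1) g'] Comp_Hom[OF h(1) f'] this] show ?thesis
      using h eq by auto
  qed
qed

end

section \<open>Zero morphisms, kernels and cokernels\<close>

context preadditive_category
begin

lemma Add_Hom: "f \<in> Hom C X Y \<Longrightarrow> g \<in> Hom C X Y \<Longrightarrow> f \<boxplus> g \<in> Hom C X Y"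
  using comm_group.axioms(2)[OF Hom_comm_group, of X Y] Hom_Obj[of f X Y]
    monoid.m_closed[OF group.is_monoid, of "Hom_group C X Y" f g]
  by (simp add: Hom_group_def)

lemma Zero_Hom: "X \<in> Obj C \<Longrightarrow> Y \<in> Obj C \<Longrightarrow> Zero C X Y \<in> Hom C X Y"
  using comm_group.axioms(2)[OF Hom_comm_group, of X Y]
    monoid.one_closed[OF group.is_monoid, of "Hom_group C X Y"]
  by (simp add: Hom_group_def)

lemma Add_Zero: "f \<in> Hom C X Y \<Longrightarrow> f \<boxplus> Zero C X Y = f"
  using comm_group.axioms(2)[OF Hom_comm_group, of X Y] Hom_Obj[of f X Y]
    monoid.r_one[OF group.is_monoid, of "Hom_group C X Y" f]
  by (simp add: Hom_group_def)

lemma Add_idem_Zero: "f \<in> Hom C X Y \<Longrightarrow> f \<boxplus> f = f \<Longrightarrow> f = Zero C X Y"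
  using comm_group.axioms(2)[OF Hom_comm_group, of X Y] Hom_Obj[of f X Y]
    group.l_cancel_one'[of "Hom_group C X Y" f f]
  by (simp add: Hom_group_def)

lemma Add_inverse:
  assumes "f \<in> Hom C X Y"
  obtains g where "g \<in> Hom C X Y" "f \<boxplus> g = Zero C X Y"
  using comm_group.axioms(2)[OF Hom_comm_group, of X Y] Hom_Obj[OF assms]
    group.r_inv_ex[of "Hom_group C X Y" f] assms
  by (auto simp: Hom_group_def)

text \<open>Since 0 + 0 = 0, bilinearity makes the composite equal to its own double, and in a group
  only the neutral element has this property.\<close>

lemma Comp_Zero_right:
  assumes "g \<in> Hom C Y Z" "X \<in> Obj C"
  shows "g \<cdot> Zero C X Y = Zero C X Z"
proof -
  note z = Zero_Hom[OF assms(2) Hom_Obj(1)[OF assms(1)]]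
  show ?thesis
    using Comp_Add_right[OF z z assms(1)] Add_Zero[OF z] Add_idem_Zero Comp_Hom[OF z assms(1)]
    by simp
qed

lemma Comp_Zero_left:
  assumes "f \<in> Hom C X Y" "Z \<in> Obj C"
  shows "Zero C Y Z \<cdot> f = Zero C X Z"
proof -
  note z = Zero_Hom[OF Hom_Obj(2)[OF assms(1)] assms(2)]
  show ?thesis
    using Comp_Add_left[OF assms(1) z z] Add_Zero[OF z] Add_idem_Zero Comp_Hom[OF assms(1) z]
    by simp
qed

lemma Hom_zero_object:
  assumes "is_zero_object C Z" "f \<in> Hom C X Z"
  shows "f = Zero C X Z"
  using assms Hom_Obj[OF assms(2)] Zero_Hom[of X Z] unfolding is_zero_object_def by blast

text \<open>Existence of lifts is separated from left cancellation of \<open>k\<close>. Cancellation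
  holds because \<open>k \<cdot> h\<close> is killed by \<open>p\<close>, so it has only one
  lift.\<close>

lemma is_kernelE:
  assumes "is_kernel C k p" "k \<in> Hom C K Y" "p \<in> Hom C Y Z"
  obtains "p \<cdot> k = Zero C K Z"
    "\<And>W g. g \<in> Hom C W Y \<Longrightarrow> p \<cdot> g = Zero C W Z \<Longrightarrow> \<exists>h \<in> Hom C W K. k \<cdot> h = g"
    "\<And>W h h'. h \<in> Hom C W K \<Longrightarrow> h' \<in> Hom C W K \<Longrightarrow> k \<cdot> h = k \<cdot> h' \<Longrightarrow> h = h'"
proof (rule that)
  show pk: "p \<cdot> k = Zero C K Z"
    using assms by (simp add: is_kernel_def Hom_iff)
  have univ: "\<exists>!h. h \<in> Hom C W K \<and> k \<cdot> h = g"
    if "g \<in> Hom C W Y" "p \<cdot> g = Zero C W Z" for W g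
    using assms that Hom_Obj(1)[OF that(1)] unfolding is_kernel_def by (simp add: Hom_iff)
  show "\<exists>h \<in> Hom C W K. k \<cdot> h = g" if "g \<in> Hom C W Y" "p \<cdot> g = Zero C W Z" for W g
    using univ[OF that] by blast
  show "h = h'" if h: "h \<in> Hom C W K" "h' \<in> Hom C W K" "k \<cdot> h = k \<cdot> h'" for W h h'
  proof -
    have "p \<cdot> (k \<cdot> h) = Zero C W Z"
      using Comp_assoc[OF h(1) assms(2,3)] pk Comp_Zero_left[OF h(1)] Hom_Obj(2)[OF assms(3)]
      by simp
    from univ[OF Comp_Hom[OF h(1) assms(2)] this] show ?thesis using h by auto
  qed
qed

text \<open>Uniqueness is recorded at the zero map, the form in which maps out of a quotient are
  shown to vanish.\<close>

lemma is_cokernelE: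
  assumes "is_cokernel C p i" "i \<in> Hom C X Y" "p \<in> Hom C Y Z"
  obtains "\<And>W g. g \<in> Hom C Y W \<Longrightarrow> g \<cdot> i = Zero C X W \<Longrightarrow> \<exists>h \<in> Hom C Z W. h \<cdot> p = g"
    "\<And>W h. h \<in> Hom C Z W \<Longrightarrow> h \<cdot> p = Zero C Y W \<Longrightarrow> h = Zero C Z W"
proof (rule that)
  have univ: "\<exists>!h. h \<in> Hom C Z W \<and> h \<cdot> p = g"
    if "g \<in> Hom C Y W" "g \<cdot> i = Zero C X W" for W g
    using assms that Hom_Obj(2)[OF that(1)] unfolding is_cokernel_def by (simp add: Hom_iff)
  show "\<exists>h \<in> Hom C Z W. h \<cdot> p = g" if "g \<in> Hom C Y W" "g \<cdot> i = Zero C X W" for W g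
    using univ[OF that] by blast
  show "h = Zero C Z W" if h: "h \<in> Hom C Z W" "h \<cdot> p = Zero C Y W" for W h
  proof -
    note Obj = Hom_Obj[OF h(1)] Hom_Obj[OF assms(2)]
    from univ[OF Zero_Hom[OF Obj(4,2)] Comp_Zero_left[OF assms(2) Obj(2)]] show ?thesis
      using h Zero_Hom[OF Obj(1,2)] Comp_Zero_left[OF assms(3) Obj(2)] by auto
  qed
qed

end

section \<open>Conflations and their pullbacks\<close>

context exact_category
begin

lemma ConflD:
  assumes "(i, p) \<in> Confl C"
  shows "is_kernel C i p" "is_cokernel C p i"
    and "i \<in> Hom C (Dom C i) (Cod C i)" "p \<in> Hom C (Cod C i) (Cod C p)"
  using Confl_kernel_cokernel[OF assms]
  by (auto simp: kernel_cokernel_pair_def is_kernel_def Hom_iff)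

lemma Confl_Hom:
  assumes "(i, p) \<in> Confl C" "p \<in> Hom C Y Z"
  shows "i \<in> Hom C (Dom C i) Y"
  using ConflD(3,4)[OF assms(1)] assms(2) by (auto simp: Hom_iff)

lemma is_iso_Ident:
  assumes "X \<in> Obj C"
  shows "is_iso C (Ident C X)"
  using Ident_Hom[OF assms] Comp_Ident_left[OF Ident_Hom[OF assms]]
  by (auto simp: is_iso_def Hom_iff)

lemma is_isoI:
  assumes "f \<in> Hom C X Y" "g \<in> Hom C Y X" "g \<cdot> f = Ident C X" "f \<cdot> g = Ident C Y"
  shows "is_iso C f"
  using assms by (auto simp: is_iso_def Hom_iff)

text \<open>Two kernels of \<open>p\<close> differ by a unique isomorphism, and \<open>Confl\<close>
  is closed under isomorphism. This serves pullbacks: the axiom gives some kernel of the pulled-back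
  map, whereas a prescribed one is wanted.\<close>

lemma Confl_kernel:
  assumes ip: "(i, p) \<in> Confl C" and jp: "is_kernel C j p"
  shows "(j, p) \<in> Confl C"
proof -
  let ?K = "Dom C i" and ?L = "Dom C j" and ?Y = "Cod C i" and ?Z = "Cod C p"
  note p = ConflD(4)[OF ip] and i = ConflD(3)[OF ip]
  have j: "j \<in> Hom C ?L ?Y" using jp p by (auto simp: is_kernel_def Hom_iff)
  obtain pi: "p \<cdot> i = Zero C ?K ?Z"
    and lift_i: "\<And>W g. g \<in> Hom C W ?Y \<Longrightarrow> p \<cdot> g = Zero C W ?Z \<Longrightarrow> \<exists>h \<in> Hom C W ?K. i \<cdot> h = g"
    and mono_i: "\<And>W h h'. h \<in> Hom C W ?K \<Longrightarrow> h' \<in> Hom C W ?K \<Longrightarrow> i \<cdot> h = i \<cdot> h' \<Longrightarrow> h = h'"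
    by (fact is_kernelE[OF ConflD(1)[OF ip] i p])
  obtain pj: "p \<cdot> j = Zero C ?L ?Z"
    and lift_j: "\<And>W g. g \<in> Hom C W ?Y \<Longrightarrow> p \<cdot> g = Zero C W ?Z \<Longrightarrow> \<exists>h \<in> Hom C W ?L. j \<cdot> h = g"
    and mono_j: "\<And>W h h'. h \<in> Hom C W ?L \<Longrightarrow> h' \<in> Hom C W ?L \<Longrightarrow> j \<cdot> h = j \<cdot> h' \<Longrightarrow> h = h'"
    by (fact is_kernelE[OF jp j p])
  obtain a where a: "a \<in> Hom C ?K ?L" "j \<cdot> a = i" using lift_j[OF i pi] by blast
  obtain b where b: "b \<in> Hom C ?L ?K" "i \<cdot> b = j" using lift_i[OF j pj] by blast
  \<comment> \<open>The two comparison maps are mutually inverse: each composite becomes the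
    identity after cancelling the kernel map on its left.\<close>
  have ba: "b \<cdot> a = Ident C ?K"
    by (rule mono_i[OF Comp_Hom[OF a(1) b(1)] Ident_Hom[OF Hom_Obj(1)[OF i]]])
      (simp add: Comp_assoc[OF a(1) b(1) i, symmetric] a b Comp_Ident_right[OF i])
  have ab: "a \<cdot> b = Ident C ?L"
    by (rule mono_j[OF Comp_Hom[OF b(1) a(1)] Ident_Hom[OF Hom_Obj(1)[OF j]]])
      (simp add: Comp_assoc[OF b(1) a(1) j, symmetric] a b Comp_Ident_right[OF j])
  have isos: "is_iso C a" "is_iso C (Ident C ?Y)" "is_iso C (Ident C ?Z)"
    using is_isoI[OF a(1) b(1) ba ab] is_iso_Ident Hom_Obj(2) i p by auto
  have iso: "iso_pairs C (i, p) (j, p)"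
    unfolding iso_pairs_def
    by (rule exI[of _ a], rule exI[of _ "Ident C ?Y"], rule exI[of _ "Ident C ?Z"])
      (use isos a i j p Ident_Hom[OF Hom_Obj(2)[OF i]] Ident_Hom[OF Hom_Obj(2)[OF p]] in
        \<open>auto simp: Hom_iff Comp_Ident_left[OF i] Comp_Ident_left[OF p] Comp_Ident_right[OF p]\<close>)
  \<comment> \<open>As \<open>i\<close> factors as \<open>j \<cdot> a\<close>, a map killing
    \<open>j\<close> also kills \<open>i\<close>, so the cokernel property of \<open>p\<close> for
    \<open>i\<close> applies.\<close>
  have "is_cokernel C p j"
    unfolding is_cokernel_def
  proof (intro conjI ballI impI)
    show "p \<in> Arr C" "j \<in> Arr C" "Dom C p = Cod C j" "p \<cdot> j = Zero C ?L ?Z"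
      using p j pj by (auto simp: Hom_iff)
    fix W g
    assume W: "W \<in> Obj C" and g: "g \<in> Hom C (Cod C j) W" and gj: "g \<cdot> j = Zero C ?L W"
    have g': "g \<in> Hom C ?Y W" using g j by (simp add: Hom_iff)
    have "g \<cdot> i = Zero C ?K W"
      using Comp_assoc[OF a(1) j g'] a gj Comp_Zero_left[OF a(1) W] by simp
    then show "\<exists>!h. h \<in> Hom C ?Z W \<and> h \<cdot> p = g"
      using ConflD(2)[OF ip] W g' by (simp add: is_cokernel_def)
  qed
  then have "kernel_cokernel_pair C (j, p)"
    using jp by (simp add: kernel_cokernel_pair_def)
  from Confl_iso_closed[OF ip this iso] show ?thesis .
qed

text \<open>Pulling back a deflation does not change its kernel: \<open>X\<close> embeds in
  \<open>Q\<close> by the map with components \<open>i\<close> and 0.\<close>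

lemma Confl_pullback:
  assumes ip: "(i, p) \<in> Confl C" "i \<in> Hom C X S" "p \<in> Hom C S Z" and f: "f \<in> Hom C Y Z"
  obtains Q j p' f' where "is_pullback C p f p' f'" "p' \<in> Hom C Q Y" "f' \<in> Hom C Q S"
    "j \<in> Hom C X Q" "f' \<cdot> j = i" "(j, p') \<in> Confl C"
proof -
  have "adm_epi C p" "f \<in> Arr C" "Cod C f = Cod C p"
    using ip f by (auto simp: adm_epi_def Hom_iff)
  from adm_epi_pullback[OF this] obtain p' f' where pb: "is_pullback C p f p' f'"
    and "adm_epi C p'" by blast
  then obtain i' where i'p': "(i', p') \<in> Confl C" by (auto simp: adm_epi_def)
  note X = Hom_Obj(1)[OF ip(2)]
  obtain pi: "p \<cdot> i = Zero C X Z"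
    and lift_i: "\<And>W g. g \<in> Hom C W S \<Longrightarrow> p \<cdot> g = Zero C W Z \<Longrightarrow> \<exists>h \<in> Hom C W X. i \<cdot> h = g"
    and mono_i: "\<And>W h h'. h \<in> Hom C W X \<Longrightarrow> h' \<in> Hom C W X \<Longrightarrow> i \<cdot> h = i \<cdot> h' \<Longrightarrow> h = h'"
    by (fact is_kernelE[OF ConflD(1)[OF ip(1)] ip(2,3)])
  obtain Q where p': "p' \<in> Hom C Q Y" and f': "f' \<in> Hom C Q S" and comm: "p \<cdot> f' = f \<cdot> p'"
    and univ: "\<And>W u v. u \<in> Hom C W S \<Longrightarrow> v \<in> Hom C W Y \<Longrightarrow> p \<cdot> u = f \<cdot> v
       \<Longrightarrow> \<exists>h \<in> Hom C W Q. f' \<cdot> h = u \<and> p' \<cdot> h = v"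
    and uniq: "\<And>W h h'. h \<in> Hom C W Q \<Longrightarrow> h' \<in> Hom C W Q \<Longrightarrow> f' \<cdot> h = f' \<cdot> h'
       \<Longrightarrow> p' \<cdot> h = p' \<cdot> h' \<Longrightarrow> h = h'"
    using is_pullbackE[OF pb ip(3) f] by metis
  note Y = Hom_Obj(1)[OF f]
  have "p \<cdot> i = f \<cdot> Zero C X Y"
    using pi Comp_Zero_right[OF f X] by simp
  from univ[OF ip(2) Zero_Hom[OF X Y] this] obtain j where
    j: "j \<in> Hom C X Q" "f' \<cdot> j = i" "p' \<cdot> j = Zero C X Y" by blast
  \<comment> \<open>If \<open>p'\<close> kills \<open>g\<close>, then \<open>p\<close> kills
    \<open>f' \<cdot> g\<close>, which therefore lifts through \<open>i\<close> to some
    \<open>h\<close>. Both projections of \<open>j \<cdot> h\<close> and \<open>g\<close> agree, and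
    cancelling \<open>i\<close> gives uniqueness.\<close>
  have "is_kernel C j p'"
    unfolding is_kernel_def
  proof (intro conjI ballI impI)
    show "j \<in> Arr C" "p' \<in> Arr C" "Cod C j = Dom C p'" "p' \<cdot> j = Zero C (Dom C j) (Cod C p')"
      using j p' by (auto simp: Hom_iff)
    fix W g
    assume W: "W \<in> Obj C" and "g \<in> Hom C W (Dom C p')" "p' \<cdot> g = Zero C W (Cod C p')"
    then have g: "g \<in> Hom C W Q" "p' \<cdot> g = Zero C W Y" using p' by (auto simp: Hom_iff)
    have "p \<cdot> (f' \<cdot> g) = Zero C W Z"
      using Comp_assoc[OF g(1) f' ip(3)] Comp_assoc[OF g(1) p' f] comm g(2) Comp_Zero_right[OF f W]
      by simp
    then obtain h where h: "h \<in> Hom C W X" "i \<cdot> h = f' \<cdot> g"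
      using lift_i[OF Comp_Hom[OF g(1) f']] by blast
    have "j \<cdot> h = g"
      by (rule uniq[OF Comp_Hom[OF h(1) j(1)] g(1)])
        (use Comp_assoc[OF h(1) j(1) f'] Comp_assoc[OF h(1) j(1) p'] j h g
          Comp_Zero_left[OF h(1) Y] in auto)
    moreover have "h' = h" if h': "h' \<in> Hom C W X" "j \<cdot> h' = g" for h'
      by (rule mono_i[OF h'(1) h(1)]) (use Comp_assoc[OF h'(1) j(1) f'] j h h' in auto)
    moreover have "Dom C j = X" using j by (simp add: Hom_iff)
    ultimately show "\<exists>!h. h \<in> Hom C W (Dom C j) \<and> j \<cdot> h = g"
      using h(1) by auto
  qed
  from that[OF pb p' f' j(1,2) Confl_kernel[OF i'p' this]] show thesis .
qed

section \<open>Lifting maps from \<open>V\<close> and from its coproducts\<close>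

text \<open>The extension lies in its own class, which must be the split one, the only element of
  \<open>Ext1 C V X\<close>. The biproduct injection of \<open>V\<close> is then the
  section.\<close>

lemma perp1_section:
  assumes X: "X \<in> perp1 C V" and jq: "(j, q) \<in> Confl C" "j \<in> Hom C X Q" "q \<in> Hom C Q V"
  obtains s where "s \<in> Hom C V Q" "q \<cdot> s = Ident C V"
proof -
  have E: "(j, q) \<in> Extensions C V X"
    using jq by (auto simp: Extensions_def Hom_iff)
  have "((j, q), (j, q)) \<in> Ext_rel C V X"
    unfolding Ext_rel_def using E jq
      Ident_Hom[OF Hom_Obj(2)[OF jq(2)]] is_iso_Ident[OF Hom_Obj(2)[OF jq(2)]]
      Comp_Ident_left[OF jq(2)] Comp_Ident_right[OF jq(3)]
    by (auto simp: Hom_iff)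
  moreover have "Ext_rel C V X `` {(j, q)} \<in> Ext1 C V X"
    using E by (auto simp: Ext1_def intro: quotientI)
  ultimately have "(j, q) \<in> Ext1_zero C V X"
    using X by (auto simp: perp1_def)
  then obtain s r where "is_biproduct C X V (Cod C j) j s r q"
    by (auto simp: Ext1_zero_def)
  then show thesis
    using that jq by (auto simp: is_biproduct_def Hom_iff)
qed

text \<open>This is exactness of Hom(V,S) -> Hom(V,Z) -> E(V,X) at the middle term when the last
  term vanishes: the pullback of the conflation along \<open>f\<close> splits, and a section
  followed by the projection to \<open>S\<close> is the lift.\<close>

lemma perp1_lift:
  assumes X: "X \<in> perp1 C V" and ip: "(i, p) \<in> Confl C" "i \<in> Hom C X S" "p \<in> Hom C S Z"
    and f: "f \<in> Hom C V Z"
  shows "\<exists>u \<in> Hom C V S. p \<cdot> u = f"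
proof -
  obtain Q j p' f' where pb: "is_pullback C p f p' f'" and p': "p' \<in> Hom C Q V"
    and f': "f' \<in> Hom C Q S" and j: "j \<in> Hom C X Q" "(j, p') \<in> Confl C"
    using Confl_pullback[OF ip f] by metis
  obtain s where s: "s \<in> Hom C V Q" "p' \<cdot> s = Ident C V"
    using perp1_section[OF X j(2,1) p'] .
  have "p \<cdot> f' = f \<cdot> p'" using pb by (simp add: is_pullback_def)
  then have "p \<cdot> (f' \<cdot> s) = f"
    using Comp_assoc[OF s(1) f' ip(3)] Comp_assoc[OF s(1) p' f] s(2) Comp_Ident_right[OF f] by simp
  then show ?thesis using Comp_Hom[OF s(1) f'] by blast
qed

text \<open>Lifts are chosen on the separate copies of \<open>V\<close> and glued by the universal
  property, so vanishing of extensions of \<open>V\<close> itself suffices.\<close>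

lemma perp1_lift_coproduct:
  assumes X: "X \<in> perp1 C V" and ip: "(i, p) \<in> Confl C" "i \<in> Hom C X S" "p \<in> Hom C S Z"
    and P: "is_coproduct C I (\<lambda>_. V) P \<iota>" and f: "f \<in> Hom C P Z"
  shows "\<exists>l \<in> Hom C P S. p \<cdot> l = f"
proof -
  have \<iota>: "\<iota> a \<in> Hom C V P" if "a \<in> I" for a
    using P that by (simp add: is_coproduct_def)
  have "\<exists>u \<in> Hom C V S. p \<cdot> u = f \<cdot> \<iota> a" if "a \<in> I" for a
    by (rule perp1_lift[OF X ip Comp_Hom[OF \<iota>[OF that] f]])
  then obtain u where u: "\<And>a. a \<in> I \<Longrightarrow> u a \<in> Hom C V S" "\<And>a. a \<in> I \<Longrightarrow> p \<cdot> u a = f \<cdot> \<iota> a"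
    by metis
  have univ: "\<exists>!h. h \<in> Hom C P Y \<and> (\<forall>a \<in> I. h \<cdot> \<iota> a = g a)"
    if "Y \<in> Obj C" "\<And>a. a \<in> I \<Longrightarrow> g a \<in> Hom C V Y" for Y g
    using P that by (simp add: is_coproduct_def)
  obtain l where l: "l \<in> Hom C P S" "\<And>a. a \<in> I \<Longrightarrow> l \<cdot> \<iota> a = u a"
    using univ[of S u] Hom_Obj(2)[OF ip(2)] u(1) by blast
  have "p \<cdot> l \<cdot> \<iota> a = f \<cdot> \<iota> a" if "a \<in> I" for a
    using Comp_assoc[OF \<iota>[OF that] l(1) ip(3)] l(2) u(2) that by simp
  moreover have "p \<cdot> l \<in> Hom C P Z" using Comp_Hom[OF l(1) ip(3)] .
  \<comment> \<open>Two maps out of the coproduct that agree on all injections are equal.\<close>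
  ultimately have "p \<cdot> l = f"
    using univ[OF Hom_Obj(2)[OF f], of "\<lambda>a. f \<cdot> \<iota> a"] f Comp_Hom[OF \<iota> f] by blast
  then show ?thesis using l(1) by blast
qed

section \<open>Closure properties of torsion classes\<close>

text \<open>In the torsion conflation of \<open>Y\<close> the map onto the torsion-free part is
  zero, so the inclusion of the torsion part is an isomorphism, and \<open>T\<close> is closed under
  isomorphism.\<close>

lemma torsionI:
  assumes tp: "s_torsion_pair C T F" and Y: "Y \<in> Obj C"
    and zero: "\<And>Z g. Z \<in> F \<Longrightarrow> g \<in> Hom C Y Z \<Longrightarrow> g = Zero C Y Z"
  shows "Y \<in> T"
proof -
  obtain i p where ip: "(i, p) \<in> Confl C" and T: "Dom C i \<in> T" and Yi: "Cod C i = Y"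
    and F: "Cod C p \<in> F"
    using tp Y unfolding s_torsion_pair_def by blast
  let ?K = "Dom C i" and ?Z = "Cod C p"
  have i: "i \<in> Hom C ?K Y" and p: "p \<in> Hom C Y ?Z"
    using ConflD(3,4)[OF ip] Yi by auto
  obtain lift: "\<And>W g. g \<in> Hom C W Y \<Longrightarrow> p \<cdot> g = Zero C W ?Z \<Longrightarrow> \<exists>h \<in> Hom C W ?K. i \<cdot> h = g"
    and mono: "\<And>W h h'. h \<in> Hom C W ?K \<Longrightarrow> h' \<in> Hom C W ?K \<Longrightarrow> i \<cdot> h = i \<cdot> h' \<Longrightarrow> h = h'"
    using is_kernelE[OF ConflD(1)[OF ip] i p] by metis
  \<comment> \<open>Since \<open>p\<close> is zero, the identity of \<open>Y\<close> factors through
    its kernel; this yields a right inverse of the monomorphism \<open>i\<close>.\<close>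
  have "p \<cdot> Ident C Y = Zero C Y ?Z"
    using Comp_Ident_right[OF p] zero[OF F p] by simp
  then obtain s where s: "s \<in> Hom C Y ?K" "i \<cdot> s = Ident C Y"
    using lift[OF Ident_Hom[OF Y]] by blast
  have "s \<cdot> i = Ident C ?K"
    by (rule mono[OF Comp_Hom[OF i s(1)] Ident_Hom[OF Hom_Obj(1)[OF i]]])
      (simp add: Comp_assoc[OF i s(1) i, symmetric] s Comp_Ident_right[OF i] Comp_Ident_left[OF i])
  then have "isomorphic C ?K Y"
    unfolding isomorphic_def using is_isoI[OF i s(1)] s(2) i by blast
  then show ?thesis
    using tp T Y by (auto simp: s_torsion_pair_def iso_closed_def)
qed

lemma torsion_zero:
  assumes "s_torsion_pair C T F" "X \<in> T" "Z \<in> F" "g \<in> Hom C X Z"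
  shows "g = Zero C X Z"
  using assms by (auto simp: s_torsion_pair_def)

text \<open>A map from \<open>Z\<close> to a torsion-free object vanishes after composition with
  \<open>p\<close>, hence vanishes, as \<open>p\<close> is a cokernel.\<close>

lemma torsion_quotient:
  assumes tp: "s_torsion_pair C T F" and ip: "(i, p) \<in> Confl C" and p: "p \<in> Hom C Y Z"
    and Y: "Y \<in> T"
  shows "Z \<in> T"
proof (rule torsionI[OF tp Hom_Obj(2)[OF p]])
  fix W g
  assume W: "W \<in> F" and g: "g \<in> Hom C Z W"
  show "g = Zero C Z W"
    using is_cokernelE[OF ConflD(2)[OF ip] Confl_Hom[OF ip p] p] g
      torsion_zero[OF tp Y W Comp_Hom[OF p g]] by metis
qed

text \<open>Here \<open>i r = f' - l p'\<close> defines the retraction \<open>r\<close> of \<open>j : X \<rightarrow> E\<close> coming from the section of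
  \<open>p' : E \<rightarrow> P\<close> induced by the lift \<open>l\<close>.\<close>

lemma torsion_of_lift:
  assumes tp: "s_torsion_pair C T F"
    and ip: "(i, p) \<in> Confl C" "i \<in> Hom C X S" "p \<in> Hom C S Z" and S: "S \<in> T"
    and kf: "(k, f) \<in> Confl C" "k \<in> Hom C A P" "f \<in> Hom C P Z" and A: "A \<in> T"
    and l: "l \<in> Hom C P S" "p \<cdot> l = f"
  shows "X \<in> T"
proof (rule torsionI[OF tp Hom_Obj(1)[OF ip(2)]])
  fix W g
  assume W: "W \<in> F" and g: "g \<in> Hom C X W"
  note Obj = Hom_Obj[OF ip(2)] Hom_Obj[OF kf(2)] Hom_Obj[OF g]
  obtain pi: "p \<cdot> i = Zero C X Z"
    and lift_i: "\<And>W g. g \<in> Hom C W S \<Longrightarrow> p \<cdot> g = Zero C W Z \<Longrightarrow> \<exists>h \<in> Hom C W X. i \<cdot> h = g"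
    and mono_i: "\<And>W h h'. h \<in> Hom C W X \<Longrightarrow> h' \<in> Hom C W X \<Longrightarrow> i \<cdot> h = i \<cdot> h' \<Longrightarrow> h = h'"
    by (fact is_kernelE[OF ConflD(1)[OF ip(1)] ip(2,3)])
  obtain fk: "f \<cdot> k = Zero C A Z"
    and lift_k: "\<And>W g. g \<in> Hom C W P \<Longrightarrow> f \<cdot> g = Zero C W Z \<Longrightarrow> \<exists>h \<in> Hom C W A. k \<cdot> h = g"
    using is_kernelE[OF ConflD(1)[OF kf(1)] kf(2,3)] by metis
  \<comment> \<open>The conflation on \<open>f\<close> is the one pulled back, so that the
    conflation \<open>A\<close> -> \<open>E\<close> -> \<open>S\<close> comes for free; the
    embedding of \<open>X\<close> in \<open>E\<close> is built by hand below.\<close>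
  obtain E d f' p' where pb: "is_pullback C f p f' p'" and f': "f' \<in> Hom C E S"
    and p': "p' \<in> Hom C E P" and d: "d \<in> Hom C A E" "p' \<cdot> d = k" and df': "(d, f') \<in> Confl C"
    using Confl_pullback[OF kf ip(3)] by metis
  obtain E' where E': "f' \<in> Hom C E' S" and comm: "f \<cdot> p' = p \<cdot> f'"
    and univ': "\<And>W u v. u \<in> Hom C W P \<Longrightarrow> v \<in> Hom C W S \<Longrightarrow> f \<cdot> u = p \<cdot> v
       \<Longrightarrow> \<exists>h \<in> Hom C W E'. p' \<cdot> h = u \<and> f' \<cdot> h = v"
    using is_pullbackE[OF pb kf(3) ip(3)] by metis
  \<comment> \<open>The elimination rule names its own apex, which is identified here as the domain
    of \<open>f'\<close>.\<close>
  have "E' = E" using E' f' by (simp add: Hom_iff)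
  note univ = univ'[unfolded this]
  have "f \<cdot> Zero C X P = p \<cdot> i"
    using pi Comp_Zero_right[OF kf(3) Obj(1)] by simp
  then obtain j where j: "j \<in> Hom C X E" "p' \<cdot> j = Zero C X P" "f' \<cdot> j = i"
    using univ[OF Zero_Hom[OF Obj(1,4)] ip(2)] by blast
  \<comment> \<open>Here \<open>m\<close> is -\<open>l\<close>. Since p f' = f p' = p l p', the
    difference f' - l p' is killed by \<open>p\<close> and factors through \<open>i\<close>.\<close>
  obtain m where m: "m \<in> Hom C P S" "l \<boxplus> m = Zero C P S"
    using Add_inverse[OF l(1)] .
  note mp' = Comp_Hom[OF p' m(1)]
  have "p \<cdot> (f' \<boxplus> m \<cdot> p') = (p \<cdot> l \<boxplus> p \<cdot> m) \<cdot> p'"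
    using Comp_Add_right[OF f' mp' ip(3)] comm l(2) Comp_assoc[OF p' m(1) ip(3)]
      Comp_Add_left[OF p' Comp_Hom[OF l(1) ip(3)] Comp_Hom[OF m(1) ip(3)]] by simp
  also have "\<dots> = Zero C E Z"
    using Comp_Add_right[OF l(1) m(1) ip(3)] m(2) Comp_Zero_right[OF ip(3) Obj(4)]
      Comp_Zero_left[OF p' Hom_Obj(2)[OF ip(3)]] by simp
  finally obtain r where r: "r \<in> Hom C E X" "i \<cdot> r = f' \<boxplus> m \<cdot> p'"
    using lift_i[OF Add_Hom[OF f' mp']] by blast
  have rj: "r \<cdot> j = Ident C X"
  proof (rule mono_i[OF Comp_Hom[OF j(1) r(1)] Ident_Hom[OF Obj(1)]])
    have "i \<cdot> (r \<cdot> j) = f' \<cdot> j \<boxplus> m \<cdot> (p' \<cdot> j)"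
      using Comp_assoc[OF j(1) r(1) ip(2)] r(2) Comp_Add_left[OF j(1) f' mp']
        Comp_assoc[OF j(1) p' m(1)] by simp
    also have "\<dots> = i"
      using j Comp_Zero_right[OF m(1) Obj(1)] Add_Zero[OF ip(2)] by simp
    finally show "i \<cdot> (r \<cdot> j) = i \<cdot> Ident C X"
      using Comp_Ident_right[OF ip(2)] by simp
  qed
  note gr = Comp_Hom[OF r(1) g]
  \<comment> \<open>As \<open>A\<close> is torsion, \<open>g \<cdot> r\<close> kills
    \<open>d\<close> and descends along \<open>f'\<close> to a map \<open>S\<close> ->
    \<open>W\<close>, which is zero because \<open>S\<close> is torsion. Restricting along
    \<open>j\<close> recovers \<open>g\<close>.\<close>
  have "g \<cdot> r \<cdot> d = Zero C A W"
    using torsion_zero[OF tp A W Comp_Hom[OF d(1) gr]] .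
  then obtain h where h: "h \<in> Hom C S W" "h \<cdot> f' = g \<cdot> r"
    using is_cokernelE[OF ConflD(2)[OF df'] d(1) f'] gr by metis
  have "g = g \<cdot> r \<cdot> j"
    using Comp_assoc[OF j(1) r(1) g] rj Comp_Ident_right[OF g] by simp
  also have "\<dots> = Zero C X W"
    using h torsion_zero[OF tp S W h(1)] Comp_Zero_left[OF f' Obj(6)] Comp_Zero_left[OF j(1) Obj(6)]
    by simp
  finally show "g = Zero C X W" .
qed

text \<open>Here \<open>i\<close> is an isomorphism, as \<open>p\<close> is zero. The case is
  separate because \<open>Pres\<close> admits zero objects outright, with no presentation to pull
  back.\<close>

lemma torsion_of_zero_quotient:
  assumes tp: "s_torsion_pair C T F"
    and ip: "(i, p) \<in> Confl C" "i \<in> Hom C X S" "p \<in> Hom C S Z" and S: "S \<in> T"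
    and Z: "is_zero_object C Z"
  shows "X \<in> T"
proof (rule torsionI[OF tp Hom_Obj(1)[OF ip(2)]])
  fix W g
  assume W: "W \<in> F" and g: "g \<in> Hom C X W"
  note Obj = Hom_Obj[OF ip(2)]
  obtain lift: "\<And>W g. g \<in> Hom C W S \<Longrightarrow> p \<cdot> g = Zero C W Z \<Longrightarrow> \<exists>h \<in> Hom C W X. i \<cdot> h = g"
    and mono: "\<And>W h h'. h \<in> Hom C W X \<Longrightarrow> h' \<in> Hom C W X \<Longrightarrow> i \<cdot> h = i \<cdot> h' \<Longrightarrow> h = h'"
    using is_kernelE[OF ConflD(1)[OF ip(1)] ip(2,3)] by metis
  have "p \<cdot> Ident C S = Zero C S Z"
    using Comp_Ident_right[OF ip(3)] Hom_zero_object[OF Z ip(3)] by simp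
  then obtain s where s: "s \<in> Hom C S X" "i \<cdot> s = Ident C S"
    using lift[OF Ident_Hom[OF Obj(2)]] by blast
  have si: "s \<cdot> i = Ident C X"
    by (rule mono[OF Comp_Hom[OF ip(2) s(1)] Ident_Hom[OF Obj(1)]])
      (simp add: Comp_assoc[OF ip(2) s(1) ip(2), symmetric] s Comp_Ident_right[OF ip(2)]
        Comp_Ident_left[OF ip(2)])
  have "g = g \<cdot> s \<cdot> i"
    using Comp_assoc[OF ip(2) s(1) g] si Comp_Ident_right[OF g] by simp
  also have "\<dots> = Zero C X W"
    using torsion_zero[OF tp S W Comp_Hom[OF s(1) g]] Comp_Zero_left[OF ip(2) Hom_Obj(2)[OF g]]
    by simp
  finally show "g = Zero C X W" .
qed

section \<open>The inclusion of \<open>perp1\<close> in \<open>Gen\<close>\<close>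

text \<open>This is the inclusion that calls for an argument; the reverse one is among the
  conditions in \<open>extended_tilting\<close>.\<close>

lemma perp1_subset_Gen:
  assumes "extended_tilting C V"
  shows "perp1 C V \<subseteq> Gen C V"
proof
  fix X
  assume X: "X \<in> perp1 C V"
  have tp: "s_torsion_pair C (Gen C V) (perp0 C V)"
    and pres: "Gen C V = Pres C V" and cogen: "cogenerating C (Gen C V)"
    using assms by (auto simp: extended_tilting_def)
  have "X \<in> Obj C" using X by (simp add: perp1_def)
  then obtain i p where ip: "(i, p) \<in> Confl C" and "Dom C i = X" and S: "Cod C i \<in> Gen C V"
    using cogen by (fastforce simp: cogenerating_def)
  then have i: "i \<in> Hom C X (Cod C i)" and p: "p \<in> Hom C (Cod C i) (Cod C p)"
    using ConflD(3,4)[OF ip] by auto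
  \<comment> \<open>The quotient of an object of \<open>Gen C V\<close> is again torsion, and
    \<open>Gen C V = Pres C V\<close> supplies a presentation with kernel in \<open>Gen C V\<close>
    unless the quotient is zero.\<close>
  have "Cod C p \<in> Pres C V"
    using torsion_quotient[OF tp ip p S] pres by simp
  then consider "is_zero_object C (Cod C p)"
    | k f and I :: "'m set" and \<iota> where "(k, f) \<in> Confl C" "is_coproduct C I (\<lambda>_. V) (Dom C f) \<iota>"
      "Cod C f = Cod C p" "Dom C k \<in> Gen C V"
    unfolding Pres_def by blast
  then show "X \<in> Gen C V"
  proof cases
    case 1
    show ?thesis by (rule torsion_of_zero_quotient[OF tp ip i p S 1])
  next
    case 2
    have f: "f \<in> Hom C (Dom C f) (Cod C p)"
      using ConflD(4)[OF 2(1)] 2(3) by (simp add: Hom_iff)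
    obtain l where l: "l \<in> Hom C (Dom C f) (Cod C i)" "p \<cdot> l = f"
      using perp1_lift_coproduct[OF X ip i p 2(2) f] by blast
    show ?thesis
      by (rule torsion_of_lift[OF tp ip i p S 2(1) Confl_Hom[OF 2(1) f] f 2(4) l])
  qed
qed

end

theorem lemma5p4:
  fixes D :: "('o, 'm, 'z) exact_scheme" and V :: 'o
  assumes "exact_category D"
    and "V \<in> Obj D"
    and "extended_tilting D V"
  shows "Gen D V = perp1 D V"
  using exact_category.perp1_subset_Gen[OF assms(1,3)] assms(3)
  by (auto simp: extended_tilting_def)

end
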